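(* Let $\mathcal N$ be one of the algebras $\langle\mathbb N;\mathrm{Suc}\rangle$, $\langle\mathbb N;+\rangle$, $\langle\mathbb N;+,\times\rangle$. For any $f\colon\mathbb N\to\mathbb N$ the following are equivalent: (i) $f$ is $\mathcal N$-stable-preorder preserving; (ii) $f^{-1}(L)\in\mathrm{Latt}^{\infty}_{\mathcal N}(L)$ for every $\mathcal N$-recognizable $L\subseteq\mathbb N$.
   Context: A relation on $\mathbb N$ is $\mathcal N$-stable if compatible with each operation of $\mathcal N$; stable preorders are stable reflexive transitive relations; congruences are stable equivalences; $f$ is stable-preorder preserving if $x\preceq y\Rightarrow f(x)\preceq f(y)$ for every stable preorder $\preceq$. $L$ is $\mathcal N$-recognizable if it is a union of classes of some congruence with finitely many classes. The 1-freezifications of an operation $\xi$ of arity $n\ge2$ are the maps $x\mapsto\xi(c_1,\dots,c_{i-1},x,c_{i+1},\dots,c_n)$ with $c_j\in\mathbb N$; a unary operation is its own 1-freezification; $\mathrm{Freez}^*(\mathcal N)$ is the set of finite (possibly empty) compositions of 1-freezifications. $\mathrm{Latt}^{\infty}_{\mathcal N}(L)$ is the smallest family of subsets of $\mathbb N$ containing $L$, closed under arbitrary (including empty) unions and intersections and under $X\mapsto\gamma^{-1}(X)$ for all $\gamma\in\mathrm{Freez}^*(\mathcal N)$. *)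

theory Defs
  imports Main
begin

text \<open>An operation of arity \<open>n\<close> is a pair \<open>(n, \<xi>)\<close>; only the values of \<open>\<xi>\<close> on lists of length
  \<open>n\<close> matter. An algebra on the natural numbers is given by its set of operations.\<close>

type_synonym operation = "nat \<times> (nat list \<Rightarrow> nat)"
type_synonym algebra = "operation set"

definition suc_algebra :: algebra where
  "suc_algebra = {(1, \<lambda>xs. Suc (xs ! 0))}"

definition add_algebra :: algebra where
  "add_algebra = {(2, \<lambda>xs. xs ! 0 + xs ! 1)}"

definition add_mult_algebra :: algebra where
  "add_mult_algebra = {(2, \<lambda>xs. xs ! 0 + xs ! 1), (2, \<lambda>xs. xs ! 0 * xs ! 1)}"

definition stable :: "algebra \<Rightarrow> nat rel \<Rightarrow> bool" where
  "stable N r \<longleftrightarrow> (\<forall>(n, \<xi>) \<in> N. \<forall>xs ys. length xs = n \<longrightarrow> length ys = n \<longrightarrow>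
     (\<forall>i<n. (xs ! i, ys ! i) \<in> r) \<longrightarrow> (\<xi> xs, \<xi> ys) \<in> r)"

definition stable_preorder :: "algebra \<Rightarrow> nat rel \<Rightarrow> bool" where
  "stable_preorder N r \<longleftrightarrow> preorder_on UNIV r \<and> stable N r"

definition congruence :: "algebra \<Rightarrow> nat rel \<Rightarrow> bool" where
  "congruence N r \<longleftrightarrow> equiv UNIV r \<and> stable N r"

definition stable_preorder_preserving :: "algebra \<Rightarrow> (nat \<Rightarrow> nat) \<Rightarrow> bool" where
  "stable_preorder_preserving N f \<longleftrightarrow>
     (\<forall>r. stable_preorder N r \<longrightarrow> (\<forall>x y. (x, y) \<in> r \<longrightarrow> (f x, f y) \<in> r))"

definition recognizable :: "algebra \<Rightarrow> nat set \<Rightarrow> bool" where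
  "recognizable N L \<longleftrightarrow>
     (\<exists>r. congruence N r \<and> finite (UNIV // r) \<and> (\<exists>C \<subseteq> UNIV // r. L = \<Union>C))"

text \<open>The entry of \<open>cs\<close> at the position \<open>i\<close> of the variable is a dummy, as it is overwritten.\<close>

inductive_set freez :: "algebra \<Rightarrow> (nat \<Rightarrow> nat) set" for N :: algebra where
  unary: "(1, \<xi>) \<in> N \<Longrightarrow> (\<lambda>x. \<xi> [x]) \<in> freez N"
| freeze: "\<lbrakk>(n, \<xi>) \<in> N; n \<ge> 2; i < n; length cs = n\<rbrakk> \<Longrightarrow> (\<lambda>x. \<xi> (cs[i := x])) \<in> freez N"

inductive_set freez_star :: "algebra \<Rightarrow> (nat \<Rightarrow> nat) set" for N :: algebra where
  empty: "id \<in> freez_star N"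
| comp: "\<lbrakk>\<phi> \<in> freez N; \<gamma> \<in> freez_star N\<rbrakk> \<Longrightarrow> \<phi> \<circ> \<gamma> \<in> freez_star N"

text \<open>In the rules \<open>Union\<close> and \<open>Inter\<close> the family \<open>S\<close> may be infinite or empty; the empty
  intersection is \<open>UNIV\<close>.\<close>

inductive_set latt_inf :: "algebra \<Rightarrow> nat set \<Rightarrow> nat set set" for N :: algebra and L :: "nat set" where
  base: "L \<in> latt_inf N L"
| Union: "(\<And>X. X \<in> S \<Longrightarrow> X \<in> latt_inf N L) \<Longrightarrow> \<Union>S \<in> latt_inf N L"
| Inter: "(\<And>X. X \<in> S \<Longrightarrow> X \<in> latt_inf N L) \<Longrightarrow> \<Inter>S \<in> latt_inf N L"
| vimage: "\<lbrakk>X \<in> latt_inf N L; \<gamma> \<in> freez_star N\<rbrakk> \<Longrightarrow> \<gamma> -` X \<in> latt_inf N L"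

end

theory Submission
  imports Defs
begin

text \<open>The sets in \<open>latt_inf N L\<close> are the up-sets of the syntactic preorder
  \<open>x \<le>\<^sub>L y \<longleftrightarrow> (\<forall>\<gamma>. \<gamma> x \<in> L \<longrightarrow> \<gamma> y \<in> L)\<close>, which is the largest stable preorder for which \<open>L\<close> is an
  up-set. Hence a map preserving stable preorders pulls \<open>L\<close> back to an up-set, for every \<open>L\<close>.
  Conversely, it is enough to test a stable preorder \<open>\<preceq>\<close> on its principal up-sets
  \<open>L = {z. c \<preceq> z}\<close>, and these are recognizable: if \<open>c \<preceq> c + k\<close> with \<open>k > 0\<close>, then translation
  invariance makes \<open>L\<close> closed under adding \<open>k\<close> beyond \<open>c\<close>, so \<open>L\<close> is ultimately periodic;
  otherwise \<open>L\<close> is finite. Ultimately periodic sets are recognizable in all three algebras.\<close>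

section \<open>Stable preorders and freezifications\<close>

lemma stable_preorder_freez:
  assumes r: "stable_preorder N r" and xy: "(x, y) \<in> r" and \<phi>: "\<phi> \<in> freez N"
  shows "(\<phi> x, \<phi> y) \<in> r"
proof -
  have refl: "(z, z) \<in> r" for z
    using r by (auto simp: stable_preorder_def preorder_on_def refl_on_def)
  have st: "(\<xi> xs, \<xi> ys) \<in> r"
    if "(n, \<xi>) \<in> N" "length xs = n" "length ys = n" "\<And>i. i < n \<Longrightarrow> (xs ! i, ys ! i) \<in> r"
    for n \<xi> xs ys
    using r that unfolding stable_preorder_def stable_def by blast
  show ?thesis
    using \<phi>
  proof cases
    case (unary \<xi>)
    then show ?thesis using st[of 1 \<xi> "[x]" "[y]"] xy by simp
  next
    case (freeze n \<xi> i cs)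
    then show ?thesis
      using st[of n \<xi> "cs[i := x]" "cs[i := y]"] xy refl by (simp add: nth_list_update)
  qed
qed

lemma stable_preorder_freez_star:
  assumes "stable_preorder N r" "(x, y) \<in> r" "\<gamma> \<in> freez_star N"
  shows "(\<gamma> x, \<gamma> y) \<in> r"
  using assms(3) by induction (use assms stable_preorder_freez in auto)

text \<open>This reduces stability to unary maps, the only maps that the definition of the syntactic
  preorder mentions.\<close>

lemma stable_preorderI_freez:
  assumes r: "preorder_on UNIV r"
    and fr: "\<And>\<phi> x y. \<phi> \<in> freez N \<Longrightarrow> (x, y) \<in> r \<Longrightarrow> (\<phi> x, \<phi> y) \<in> r"
  shows "stable_preorder N r"
proof -
  have refl: "(z, z) \<in> r" for z
    using r by (auto simp: preorder_on_def refl_on_def)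
  have trans: "trans r"
    using r by (simp add: preorder_on_def)
  have "(\<xi> xs, \<xi> ys) \<in> r"
    if N: "(n, \<xi>) \<in> N" and len: "length xs = n" "length ys = n"
      and xy: "\<forall>i<n. (xs ! i, ys ! i) \<in> r" for n \<xi> xs ys
  proof -
    consider "n = 0" | "n = 1" | "n \<ge> 2" by linarith
    then show ?thesis
    proof cases
      case 1
      then show ?thesis using len refl by simp
    next
      case 2
      then obtain x y where "xs = [x]" "ys = [y]"
        using len by (metis One_nat_def length_0_conv length_Suc_conv)
      then show ?thesis using fr[OF freez.unary] N 2 xy by simp
    next
      case 3
      \<comment> \<open>Replace the arguments one at a time and use transitivity.\<close>
      have "(\<xi> xs, \<xi> (take k ys @ drop k xs)) \<in> r" if "k \<le> n" for k
        using that
      proof (induction k)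
        case 0
        then show ?case using refl by simp
      next
        case (Suc k)
        let ?zs = "take k ys @ drop k xs"
        have k: "k < n" using Suc by simp
        have "(\<xi> (?zs[k := xs ! k]), \<xi> (?zs[k := ys ! k])) \<in> r"
          using fr[OF freez.freeze[of n \<xi> N k ?zs]] N 3 k len xy by simp
        moreover have "?zs[k := xs ! k] = ?zs"
          using k len by (simp add: list_update_append Cons_nth_drop_Suc[symmetric])
        moreover have "?zs[k := ys ! k] = take (Suc k) ys @ drop (Suc k) xs"
          using k len
          by (simp add: list_update_append Cons_nth_drop_Suc[symmetric] take_Suc_conv_app_nth)
        ultimately show ?case using Suc trans by (auto dest: transD)
      qed
      from this[of n] show ?thesis using len by simp
    qed
  qed
  then show ?thesis
    using r unfolding stable_preorder_def stable_def by blast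
qed

text \<open>The rule \<open>comp\<close> adds the new factor outermost. Stability of the syntactic
  preorder needs it innermost: testing \<phi> x with \<gamma> is testing x with \<gamma> \<circ>
  \<phi>.\<close>

lemma freez_star_comp_freez:
  assumes "\<gamma> \<in> freez_star N" "\<phi> \<in> freez N"
  shows "\<gamma> \<circ> \<phi> \<in> freez_star N"
  using assms(1)
proof induction
  case empty
  then show ?case
    using freez_star.comp[OF assms(2) freez_star.empty] by simp
next
  case (comp \<psi> \<gamma>)
  show ?case
    using freez_star.comp[OF comp.hyps(1) comp.IH] by (simp only: comp_assoc)
qed

section \<open>The syntactic preorder and its up-sets\<close>

definition syntactic_preorder :: "algebra \<Rightarrow> nat set \<Rightarrow> nat rel" where
  "syntactic_preorder N L = {(x, y). \<forall>\<gamma> \<in> freez_star N. \<gamma> x \<in> L \<longrightarrow> \<gamma> y \<in> L}"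

lemma stable_preorder_syntactic_preorder: "stable_preorder N (syntactic_preorder N L)"
proof (rule stable_preorderI_freez)
  show "preorder_on UNIV (syntactic_preorder N L)"
    by (auto simp: preorder_on_def syntactic_preorder_def refl_on_def trans_def)
next
  fix \<phi> x y
  assume "\<phi> \<in> freez N" "(x, y) \<in> syntactic_preorder N L"
  then show "(\<phi> x, \<phi> y) \<in> syntactic_preorder N L"
    using freez_star_comp_freez by (fastforce simp: syntactic_preorder_def)
qed

lemma upset_mem_latt_inf:
  assumes "\<And>x y. (x, y) \<in> syntactic_preorder N L \<Longrightarrow> x \<in> X \<Longrightarrow> y \<in> X"
  shows "X \<in> latt_inf N L"
proof -
  \<comment> \<open>\<open>U x\<close> is the principal up-set of x in the syntactic preorder,
    written as an intersection of preimages of \<open>L\<close>; an up-set is the union of the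
    \<open>U x\<close> over its elements.\<close>
  define U where "U x = \<Inter>{\<gamma> -` L | \<gamma>. \<gamma> \<in> freez_star N \<and> \<gamma> x \<in> L}" for x
  have U: "U x \<in> latt_inf N L" for x
    unfolding U_def by (rule latt_inf.Inter) (auto intro: latt_inf.vimage latt_inf.base)
  have "U x = {y. (x, y) \<in> syntactic_preorder N L}" for x
    by (auto simp: U_def syntactic_preorder_def)
  then have "X = \<Union>(U ` X)"
    using assms by (auto simp: syntactic_preorder_def)
  moreover have "\<Union>(U ` X) \<in> latt_inf N L"
    using U by (intro latt_inf.Union) auto
  ultimately show ?thesis by simp
qed

text \<open>Up-sets of \<open>r\<close> survive unions and intersections, and also preimages under
  \<gamma>, because \<gamma> is monotone for \<open>r\<close>.\<close>

lemma latt_inf_upset: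
  assumes X: "X \<in> latt_inf N L" and r: "stable_preorder N r"
    and L: "\<And>x y. (x, y) \<in> r \<Longrightarrow> x \<in> L \<Longrightarrow> y \<in> L"
    and "(x, y) \<in> r" "x \<in> X"
  shows "y \<in> X"
  using X assms(4,5)
proof (induction arbitrary: x y)
  case base
  then show ?case using L by blast
next
  case (vimage X \<gamma>)
  then show ?case using stable_preorder_freez_star[OF r] by blast
qed blast+

lemma vimage_mem_latt_inf:
  assumes "stable_preorder_preserving N f"
  shows "f -` L \<in> latt_inf N L"
proof (rule upset_mem_latt_inf)
  fix x y
  assume "(x, y) \<in> syntactic_preorder N L" "x \<in> f -` L"
  moreover from this have "(f x, f y) \<in> syntactic_preorder N L"
    using assms stable_preorder_syntactic_preorder by (auto simp: stable_preorder_preserving_def)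
  ultimately show "y \<in> f -` L"
    using freez_star.empty by (fastforce simp: syntactic_preorder_def)
qed

section \<open>Principal up-sets are recognizable\<close>

text \<open>For \<open>k > 0\<close> the additive quotient is the finite monogenic monoid of index
  \<open>t\<close> and period \<open>k\<close>: singletons below \<open>t\<close>, residue classes
  from \<open>t\<close> on.\<close>

definition period_congruence :: "nat \<Rightarrow> nat \<Rightarrow> nat rel" where
  "period_congruence t k = {(x, y). x = y \<or> t \<le> x \<and> t \<le> y \<and> x mod k = y mod k}"

lemma period_congruence_add:
  assumes "(a, b) \<in> period_congruence t k" "(c, d) \<in> period_congruence t k"
  shows "(a + c, b + d) \<in> period_congruence t k"
  using assms by (auto simp: period_congruence_def intro: mod_add_cong)

lemma period_congruence_mult:
  assumes "(a, b) \<in> period_congruence t k" "(c, d) \<in> period_congruence t k"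
  shows "(a * c, b * d) \<in> period_congruence t k"
proof -
  have l: "t \<le> x * y" if "t \<le> x" "y \<noteq> 0 \<or> t \<le> y" for x y :: nat
    using that mult_le_mono[of t x 1 y] by (cases "y = 0") auto
  have r: "t \<le> x * y" if "t \<le> y" "x \<noteq> 0 \<or> t \<le> x" for x y :: nat
    using l[OF that] by (simp add: mult.commute)
  \<comment> \<open>A product with a factor at least \<open>t\<close> can drop below
    \<open>t\<close> only if the other factor is 0. If that 0 is shared by both sides, the products
    agree; otherwise \<open>t\<close> itself is 0.\<close>
  have "t \<le> a * c \<and> t \<le> b * d" if "a * c \<noteq> b * d"
    using assms that l[of a c] l[of b d] r[of c a] r[of d b]
    by (auto simp: period_congruence_def)
  moreover have "(a * c) mod k = (b * d) mod k"
    using assms by (auto simp: period_congruence_def intro: mod_mult_cong)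
  ultimately show ?thesis
    by (auto simp: period_congruence_def)
qed

lemma congruence_period_congruence:
  assumes "N \<in> {suc_algebra, add_algebra, add_mult_algebra}"
  shows "congruence N (period_congruence t k)"
proof -
  have "equiv UNIV (period_congruence t k)"
    by (auto simp: equiv_def period_congruence_def refl_on_def sym_def trans_def)
  moreover have "(Suc a, Suc b) \<in> period_congruence t k" if "(a, b) \<in> period_congruence t k" for a b
    using period_congruence_add[OF that, of 1 1] by (simp add: period_congruence_def)
  ultimately show ?thesis
    using assms period_congruence_add period_congruence_mult
    by (auto simp: congruence_def stable_def suc_algebra_def add_algebra_def add_mult_algebra_def)
qed

lemma finite_quotient_period_congruence:
  assumes "k > 0"
  shows "finite (UNIV // period_congruence t k)"
proof -
  let ?r = "period_congruence t k"
  have eq: "equiv UNIV ?r"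
    using congruence_period_congruence[of suc_algebra] by (simp add: congruence_def)
  have "\<exists>y < t + k. ?r `` {x} = ?r `` {y}" for x
  proof (cases "x < t")
    case True
    then have "x < t + k" by simp
    then show ?thesis by blast
  next
    case False
    \<comment> \<open>This representative of x lies in the window from \<open>t\<close> to
      \<open>t + k - 1\<close>.\<close>
    let ?y = "t + (x - t) mod k"
    have "(x, ?y) \<in> ?r"
      using False by (simp add: period_congruence_def mod_add_right_eq)
    then show ?thesis
      using assms equiv_class_eq[OF eq] by (metis add_strict_left_mono mod_less_divisor)
  qed
  then have "UNIV // ?r \<subseteq> (\<lambda>y. ?r `` {y}) ` {..<t + k}"
    by (auto simp: quotient_def)
  then show ?thesis
    by (rule finite_subset) simp
qed

lemma recognizable_ultimately_periodic:
  assumes N: "N \<in> {suc_algebra, add_algebra, add_mult_algebra}" and "k > 0"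
    and per: "\<And>x. x \<ge> t \<Longrightarrow> x \<in> L \<longleftrightarrow> x + k \<in> L"
  shows "recognizable N L"
proof -
  let ?r = "period_congruence t k"
  have shift: "x + j * k \<in> L \<longleftrightarrow> x \<in> L" if "x \<ge> t" for x j
  proof (induction j)
    case (Suc j)
    then show ?case using per[of "x + j * k"] that by (simp add: ac_simps)
  qed simp
  have ordered: "x \<in> L \<longleftrightarrow> y \<in> L" if xy: "t \<le> x" "x \<le> y" "x mod k = y mod k" for x y
  proof -
    obtain j where "y = x + k * j"
      by (rule mod_eq_nat1E[OF xy(3)[symmetric] xy(2)])
    then show ?thesis using shift[OF xy(1), of j] by (simp add: mult.commute)
  qed
  have "y \<in> L" if "(x, y) \<in> ?r" "x \<in> L" for x y
    using that ordered[of x y] ordered[of y x] linear[of x y]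
    unfolding period_congruence_def by fastforce
  then have "\<Union>((\<lambda>x. ?r `` {x}) ` L) \<subseteq> L"
    by blast
  moreover have "x \<in> ?r `` {x}" for x
    by (simp add: period_congruence_def)
  ultimately have "L = \<Union>((\<lambda>x. ?r `` {x}) ` L)"
    by blast
  moreover have "(\<lambda>x. ?r `` {x}) ` L \<subseteq> UNIV // ?r"
    by (auto simp: quotient_def)
  ultimately have "\<exists>C \<subseteq> UNIV // ?r. L = \<Union>C"
    by (intro exI[of _ "(\<lambda>x. ?r `` {x}) ` L"] conjI)
  then show ?thesis
    using congruence_period_congruence[OF N] finite_quotient_period_congruence[OF \<open>k > 0\<close>]
    unfolding recognizable_def by (intro exI[of _ ?r] conjI)
qed

section \<open>Ultimate periodicity of principal up-sets\<close>

lemma ultimately_periodic_if_shift_closed: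
  fixes L :: "nat set"
  assumes "k > 0" and shift: "\<And>x. x \<ge> c \<Longrightarrow> x \<in> L \<Longrightarrow> x + k \<in> L"
  shows "\<exists>t. \<forall>x\<ge>t. x \<in> L \<longleftrightarrow> x + k \<in> L"
proof -
  \<comment> \<open>Each residue class enters \<open>L\<close> at most once beyond \<open>c\<close>.\<close>
  define D where "D = {x. x \<ge> c \<and> x \<notin> L \<and> x + k \<in> L}"
  \<comment> \<open>The count starts at one step, since x itself lies outside
    \<open>L\<close>.\<close>
  have iter: "x + Suc j * k \<in> L" if "x \<in> D" for x j
  proof (induction j)
    case 0
    then show ?case using that by (simp add: D_def)
  next
    case (Suc j)
    then show ?case using shift[of "x + Suc j * k"] that by (simp add: D_def ac_simps)
  qed
  have no_less: False if xy: "x \<in> D" "y \<in> D" "x mod k = y mod k" "x < y" for x y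
  proof -
    obtain j where j: "y = x + k * j"
      by (rule mod_eq_nat1E[OF xy(3)[symmetric] less_imp_le[OF xy(4)]])
    then obtain i where "j = Suc i"
      using xy(4) by (cases j) auto
    then show False
      using iter[OF xy(1), of i] j xy(2) by (simp add: D_def mult.commute)
  qed
  have "inj_on (\<lambda>x. x mod k) D"
  proof (rule inj_onI)
    fix x y
    assume "x \<in> D" "y \<in> D" "x mod k = y mod k"
    then show "x = y"
      using no_less[of x y] no_less[of y x] by (cases x y rule: linorder_cases) simp_all
  qed
  moreover have "(\<lambda>x. x mod k) ` D \<subseteq> {..<k}"
    using \<open>k > 0\<close> by auto
  ultimately have "finite D"
    by (rule inj_on_finite) simp
  then obtain s where "\<forall>x\<in>D. x < s"
    using finite_nat_set_iff_bounded by blast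
  \<comment> \<open>From \<open>c\<close> on, adding \<open>k\<close> never leaves \<open>L\<close>;
    from \<open>s\<close> on, it never enters \<open>L\<close>.\<close>
  then have "x \<in> L \<longleftrightarrow> x + k \<in> L" if "x \<ge> max s c" for x
    using that shift[of x] by (auto simp: D_def)
  then show ?thesis by blast
qed

lemma stable_preorder_Suc:
  assumes N: "N \<in> {suc_algebra, add_algebra, add_mult_algebra}"
    and r: "stable_preorder N r" and xy: "(x, y) \<in> r"
  shows "(Suc x, Suc y) \<in> r"
proof (cases "N = suc_algebra")
  case True
  then have "(\<lambda>x. Suc ([x] ! 0)) \<in> freez N"
    by (intro freez.unary) (simp add: suc_algebra_def)
  from stable_preorder_freez[OF r xy this] show ?thesis by simp
next
  case False
  then have "(2, \<lambda>xs. xs ! 0 + xs ! 1) \<in> N"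
    using N by (auto simp: add_algebra_def add_mult_algebra_def)
  from freez.freeze[OF this, of 0 "[0, 1]"] stable_preorder_freez[OF r xy]
  show ?thesis by fastforce
qed

lemma recognizable_principal_upset:
  assumes N: "N \<in> {suc_algebra, add_algebra, add_mult_algebra}"
    and r: "stable_preorder N r"
  shows "recognizable N {z. (c, z) \<in> r}"
proof -
  let ?L = "{z. (c, z) \<in> r}"
  have "\<exists>k>0. \<exists>t. \<forall>x\<ge>t. x \<in> ?L \<longleftrightarrow> x + k \<in> ?L"
  proof (cases "\<exists>k>0. c + k \<in> ?L")
    case True
    then obtain k where k: "k > 0" "(c, c + k) \<in> r" by auto
    \<comment> \<open>Translation by m is iterated successor, which is monotone in all three
      algebras.\<close>
    have translate: "(c + m, c + m + k) \<in> r" for m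
      by (induction m) (use k stable_preorder_Suc[OF N r] in auto)
    have "x + k \<in> ?L" if "x \<ge> c" "x \<in> ?L" for x
      using translate[of "x - c"] that r
      by (auto simp: stable_preorder_def preorder_on_def dest: transD)
    then show ?thesis
      using ultimately_periodic_if_shift_closed[OF k(1)] k(1) by blast
  next
    case False
    then have "x \<notin> ?L" if "x > c" for x
      using that by (metis less_imp_add_positive)
    \<comment> \<open>Nothing beyond \<open>c\<close> lies in the set, so period 1 works
      there.\<close>
    then have "\<forall>x\<ge>Suc c. x \<in> ?L \<longleftrightarrow> x + 1 \<in> ?L" by auto
    then show ?thesis by (metis zero_less_one)
  qed
  then show ?thesis
    using recognizable_ultimately_periodic[OF N] by blast
qed

theorem theorem5p14:
  fixes N :: algebra and f :: "nat \<Rightarrow> nat"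
  assumes "N \<in> {suc_algebra, add_algebra, add_mult_algebra}"
  shows "stable_preorder_preserving N f \<longleftrightarrow>
    (\<forall>L. recognizable N L \<longrightarrow> f -` L \<in> latt_inf N L)"
proof
  assume "stable_preorder_preserving N f"
  then show "\<forall>L. recognizable N L \<longrightarrow> f -` L \<in> latt_inf N L"
    using vimage_mem_latt_inf by blast
next
  assume latt: "\<forall>L. recognizable N L \<longrightarrow> f -` L \<in> latt_inf N L"
  show "stable_preorder_preserving N f"
    unfolding stable_preorder_preserving_def
  proof (intro allI impI)
    fix r x y
    assume r: "stable_preorder N r" and xy: "(x, y) \<in> r"
    \<comment> \<open>Chosen so that membership of y in the preimage is exactly the goal; x is in it
      by reflexivity, and the preimage is an up-set of \<open>r\<close>.\<close>
    let ?L = "{z. (f x, z) \<in> r}"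
    have "f -` ?L \<in> latt_inf N ?L"
      using latt recognizable_principal_upset[OF assms r] by blast
    moreover have "w \<in> ?L" if "(z, w) \<in> r" "z \<in> ?L" for z w
      using r that by (auto simp: stable_preorder_def preorder_on_def dest: transD)
    moreover have "x \<in> f -` ?L"
      using r by (auto simp: stable_preorder_def preorder_on_def refl_on_def)
    ultimately have "y \<in> f -` ?L"
      using latt_inf_upset[OF _ r] xy by blast
    then show "(f x, f y) \<in> r" by simp
  qed
qed

end
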